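(* (1) For all integers $n \geq 1$, either $X(Y(n)) = X(n)+Y(n)$ or $Y(X(n)) = X(n)+Y(n)$. (2) For all integers $n \geq 1$, we have $X(n)+Y(n)-Y(X(n)) \in \{0,1,2\}$.
   Context: The sequences $(X(n))_{n\ge 0}$ and $(Y(n))_{n\ge 0}$ of non-negative integers (OEIS A140100 and A140101) are defined recursively as follows. Start with $X(0)=0$, $Y(0)=0$, $X(1)=1$, $Y(1)=2$. For $n>1$, choose the least positive integers $Y(n)>X(n)$ such that neither $Y(n)$ nor $X(n)$ appears in $\{Y(k) : 1\le k<n\}$ or $\{X(k): 1\le k<n\}$, and such that $Y(n)-X(n)$ does not appear in $\{Y(k)-X(k): 1\le k<n\}$ or $\{Y(k)+X(k): 1\le k<n\}$. Here "least" means: call $(n,x,y)$ good if $y>x$ are positive integers satisfying all of these conditions with $(x,y)$ in place of $(X(n),Y(n))$; then $X(n)$ is the least $x$ such that $(n,x,y)$ is good for some $y$, and $Y(n)$ is the least $y$ such that $(n,X(n),y)$ is good. First values for $n=0,1,2,\ldots$: $X = 0,1,3,4,6,7,9,10,12,14,15,\ldots$ and $Y = 0,2,5,8,11,13,16,19,22,25,28,\ldots$. *)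

theory Defs
  imports Main
begin

text \<open>
  The differences are taken in the integers, so that truncated subtraction plays no role.
\<close>

definition good :: "(nat \<Rightarrow> nat) \<Rightarrow> (nat \<Rightarrow> nat) \<Rightarrow> nat \<Rightarrow> nat \<Rightarrow> nat \<Rightarrow> bool" where
  "good X Y n x y \<longleftrightarrow>
     0 < x \<and> x < y \<and>
     y \<notin> Y ` {1..<n} \<and> y \<notin> X ` {1..<n} \<and>
     x \<notin> Y ` {1..<n} \<and> x \<notin> X ` {1..<n} \<and>
     int y - int x \<notin> (\<lambda>k. int (Y k) - int (X k)) ` {1..<n} \<and>
     int y - int x \<notin> (\<lambda>k. int (Y k) + int (X k)) ` {1..<n}"

text \<open>
  \<open>good X Y n\<close> depends only on the values of \<open>X\<close> and \<open>Y\<close> below \<open>n\<close>; this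
  is what makes the recursion below terminate.
\<close>

lemma good_cong [fundef_cong]:
  assumes "n = n'"
    and "\<And>k. 1 \<le> k \<Longrightarrow> k < n' \<Longrightarrow> X k = X' k"
    and "\<And>k. 1 \<le> k \<Longrightarrow> k < n' \<Longrightarrow> Y k = Y' k"
  shows "good X Y n = good X' Y' n'"
  using assms by (intro ext) (auto simp: good_def image_iff)

function seqX :: "nat \<Rightarrow> nat" and seqY :: "nat \<Rightarrow> nat" where
  "seqX n = (if n = 0 then 0 else if n = 1 then 1
             else (LEAST x. \<exists>y. good seqX seqY n x y))"
| "seqY n = (if n = 0 then 0 else if n = 1 then 2
             else (LEAST y. good seqX seqY n (seqX n) y))"
  by pat_completeness auto
termination
  by (relation "measures [case_sum id id, case_sum (\<lambda>_. 0) (\<lambda>_. 1)]") auto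

declare seqX.simps [simp del] seqY.simps [simp del]

end

theory Submission
  imports Defs "HOL-Library.Sublist"
begin

text \<open>
  The greedy rule says that \<open>X(n)\<close> is the least positive integer that is not an earlier value of
  \<open>X\<close> or \<open>Y\<close>, and that \<open>Y(n) - X(n)\<close> is the least one that is not an earlier value of
  \<open>Y - X\<close> or \<open>Y + X\<close>. The increments of \<open>(X, Y - X)\<close> turn out to be \<open>(2,1)\<close>, \<open>(1,2)\<close>,
  \<open>(1,1)\<close>, arranged as the letters \<open>a\<close>, \<open>b\<close>, \<open>c\<close> of the Tribonacci word, the fixed
  point of \<open>a \<mapsto> ab, b \<mapsto> ac, c \<mapsto> a\<close>: the \<open>k\<close>-th \<open>a\<close> (respectively \<open>b\<close>) of this word
  sits at the place where the substitution (respectively its square) puts the image of the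
  \<open>k\<close>-th letter, and so the values skipped by \<open>X\<close> (respectively \<open>Y - X\<close>) are those of \<open>Y\<close>
  (respectively \<open>X + Y\<close>).

  Both claims follow from \<open>Y(X(n)) \<le> X(n) + Y(n) < Y(X(n) + 1)\<close>, which compares two prefixes
  of the Tribonacci word, of lengths \<open>n - 1\<close> and \<open>X(n) - 1\<close>. The balanced pair algorithm cuts
  the two copies of the word simultaneously into blocks such that the error returns to \<open>0\<close> at the
  end of each block. Only nine pairs of blocks occur, and the inequality is checked inside each.
\<close>

section \<open>The Tribonacci word\<close>

datatype letter = La | Lb | Lc

fun subst :: "letter \<Rightarrow> letter list" where
  "subst La = [La, Lb]"
| "subst Lb = [La, Lc]"
| "subst Lc = [La]"

definition ph :: "letter list \<Rightarrow> letter list" where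
  "ph w = concat (map subst w)"

lemma ph_simps [simp]:
  "ph [] = []" "ph (x # w) = subst x @ ph w" "ph (v @ w) = ph v @ ph w"
  by (simp_all add: ph_def)

lemma ph_pow_append: "(ph ^^ k) (v @ w) = (ph ^^ k) v @ (ph ^^ k) w"
  by (induction k) simp_all

lemma prefix_ph: "prefix v w \<Longrightarrow> prefix (ph v) (ph w)"
  by (auto simp: prefix_def)

lemma length_ph: "length w \<le> length (ph w)"
proof (induction w)
  case (Cons x w)
  then show ?case by (cases x) auto
qed simp

definition trib :: "nat \<Rightarrow> letter list" where
  "trib k = (ph ^^ k) [La]"

lemma trib_Suc: "trib (Suc k) = trib k @ (ph ^^ k) [Lb]"
  using ph_pow_append[of k "[La]" "[Lb]"] by (simp add: trib_def funpow_swap1)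

lemma ph_trib: "ph (trib k) = trib (Suc k)"
  by (simp add: trib_def)

lemma prefix_trib: "k \<le> l \<Longrightarrow> prefix (trib k) (trib l)"
proof (induction rule: dec_induct)
  case (step l)
  then show ?case by (auto simp: trib_Suc prefix_def)
qed simp

lemma length_trib: "k < length (trib k)"
proof (induction k)
  case (Suc k)
  have "length [Lb] \<le> length ((ph ^^ k) [Lb])"
    by (induction k) (use length_ph order_trans in auto)
  with Suc show ?case by (simp add: trib_Suc)
qed (simp add: trib_def)

definition trib_prefix :: "letter list \<Rightarrow> bool" where
  "trib_prefix w \<longleftrightarrow> (\<exists>k. prefix w (trib k))"

text \<open>The infinite word is never formed: the \<open>trib k\<close> are nested and
  \<open>trib n\<close> has more than \<open>n\<close> letters, so this is the prefix of length
  \<open>n\<close> of their limit.\<close>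

definition pre :: "nat \<Rightarrow> letter list" where
  "pre n = take n (trib n)"

definition letter_at :: "nat \<Rightarrow> letter" where
  "letter_at n = pre (Suc n) ! n"

lemma length_pre [simp]: "length (pre n) = n"
  using length_trib[of n] by (simp add: pre_def)

lemma trib_prefix_pre [simp]: "trib_prefix (pre n)"
  unfolding trib_prefix_def pre_def by (blast intro: take_is_prefix)

lemma trib_prefix_linear:
  assumes "trib_prefix v" "trib_prefix w" "length v \<le> length w"
  shows "prefix v w"
proof -
  obtain k l where "prefix v (trib k)" "prefix w (trib l)"
    using assms by (auto simp: trib_prefix_def)
  then have "prefix v (trib (max k l))" "prefix w (trib (max k l))"
    using prefix_trib by (meson max.cobounded1 max.cobounded2 prefix_order.trans)+
  with assms(3) show ?thesis
    using prefix_length_prefix by blast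
qed

lemma trib_prefix_eq: "trib_prefix w \<Longrightarrow> w = pre (length w)"
  by (metis length_pre le_refl prefix_order.antisym trib_prefix_linear trib_prefix_pre)

lemma trib_prefix_take: "trib_prefix w \<Longrightarrow> trib_prefix (take n w)"
  unfolding trib_prefix_def by (meson prefix_order.trans take_is_prefix)

lemma take_trib_prefix: "trib_prefix w \<Longrightarrow> n \<le> length w \<Longrightarrow> take n w = pre n"
  using trib_prefix_eq[OF trib_prefix_take[of w n]] by simp

lemma trib_prefix_ph: "trib_prefix w \<Longrightarrow> trib_prefix (ph w)"
  unfolding trib_prefix_def by (metis ph_trib prefix_ph)

lemma pre_0 [simp]: "pre 0 = []"
  by (simp add: pre_def)

lemma pre_Suc: "pre (Suc n) = pre n @ [letter_at n]"
proof -
  have "take n (pre (Suc n)) = pre n"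
    by (rule take_trib_prefix) simp_all
  then show ?thesis
    using take_Suc_conv_app_nth[of n "pre (Suc n)"] by (simp add: letter_at_def)
qed

lemma pre_prefix: "i \<le> k \<Longrightarrow> prefix (pre i) (pre k)"
  by (rule trib_prefix_linear) simp_all

lemma prefix_pre_eq: "prefix w (pre k) \<Longrightarrow> w = pre (length w)"
  by (rule trib_prefix_eq)
    (meson prefix_order.trans trib_prefix_def trib_prefix_pre)

lemma pre_snoc: "trib_prefix (w @ [x]) \<Longrightarrow> pre (length w) = w \<and> letter_at (length w) = x"
  using trib_prefix_eq[of "w @ [x]"] by (simp add: pre_Suc)

section \<open>Positions of the letters \<open>La\<close> and \<open>Lb\<close>\<close>

definition posA :: "nat \<Rightarrow> nat" where
  "posA k = length (ph (pre k))"

text \<open>Every \<open>ph (ph [x])\<close> begins with \<open>[La, Lb]\<close> and contains no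
  further \<open>Lb\<close>; the \<open>Suc\<close> skips the leading \<open>La\<close>.\<close>

definition posB :: "nat \<Rightarrow> nat" where
  "posB k = Suc (length (ph (ph (pre k))))"

lemma pre_posA: "pre (posA k) = ph (pre k)" and letter_posA: "letter_at (posA k) = La"
proof -
  have "trib_prefix (ph (pre (Suc k)))"
    by (simp only: trib_prefix_ph trib_prefix_pre)
  moreover have "prefix (ph (pre k) @ [La]) (ph (pre (Suc k)))"
    by (cases "letter_at k") (auto simp: pre_Suc prefix_def)
  ultimately have "trib_prefix (ph (pre k) @ [La])"
    unfolding trib_prefix_def by (meson prefix_order.trans)
  from pre_snoc[OF this] show "pre (posA k) = ph (pre k)" "letter_at (posA k) = La"
    by (auto simp: posA_def)
qed

lemma pre_posB: "pre (posB k) = ph (ph (pre k)) @ [La]" and letter_posB: "letter_at (posB k) = Lb"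
proof -
  have "trib_prefix (ph (ph (pre (Suc k))))"
    by (simp only: trib_prefix_ph trib_prefix_pre)
  moreover have "prefix ((ph (ph (pre k)) @ [La]) @ [Lb]) (ph (ph (pre (Suc k))))"
    by (cases "letter_at k") (auto simp: pre_Suc prefix_def)
  ultimately have "trib_prefix ((ph (ph (pre k)) @ [La]) @ [Lb])"
    unfolding trib_prefix_def by (meson prefix_order.trans)
  from pre_snoc[OF this] show "pre (posB k) = ph (ph (pre k)) @ [La]" "letter_at (posB k) = Lb"
    by (auto simp: posB_def)
qed

text \<open>Desubstitution: every \<open>subst x\<close> has its only \<open>La\<close> in front, so
  a cut before an \<open>La\<close> falls between images of letters.\<close>

lemma prefix_ph_La: "prefix (w @ [La]) (ph v) \<Longrightarrow> \<exists>v'. prefix v' v \<and> w = ph v'"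
proof (induction v arbitrary: w)
  case (Cons x v)
  show ?case
  proof (cases "w = []")
    case True
    then show ?thesis by (intro exI[of _ "[]"]) simp
  next
    case False
    with Cons.prems have "\<exists>w'. w = subst x @ w' \<and> prefix (w' @ [La]) (ph v)"
      by (cases x) (auto simp: prefix_Cons Cons_eq_append_conv append_eq_Cons_conv)
    then obtain w' where w': "w = subst x @ w'" "prefix (w' @ [La]) (ph v)"
      by blast
    from Cons.IH[OF w'(2)] obtain v' where "prefix v' v" "w' = ph v'" by blast
    with w'(1) show ?thesis by (intro exI[of _ "x # v'"]) simp
  qed
qed simp

lemma prefix_ph_Lb: "prefix (w @ [Lb]) (ph v) \<Longrightarrow> \<exists>v'. prefix (v' @ [La]) v \<and> w = ph v' @ [La]"
proof (induction v arbitrary: w)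
  case (Cons x v)
  show ?case
  proof (cases "w = [La] \<and> x = La")
    case True
    then show ?thesis by (intro exI[of _ "[]"]) simp
  next
    case False
    with Cons.prems have "\<exists>w'. w = subst x @ w' \<and> prefix (w' @ [Lb]) (ph v)"
      by (cases x) (auto simp: prefix_Cons Cons_eq_append_conv append_eq_Cons_conv)
    then obtain w' where w': "w = subst x @ w'" "prefix (w' @ [Lb]) (ph v)"
      by blast
    from Cons.IH[OF w'(2)] obtain v' where "prefix (v' @ [La]) v" "w' = ph v' @ [La]" by blast
    with w'(1) show ?thesis by (intro exI[of _ "x # v'"]) simp
  qed
qed simp

lemma letter_La_imp:
  assumes "letter_at i = La"
  shows "\<exists>k. i = posA k"
proof -
  \<comment> \<open>The word is fixed by \<open>ph\<close>, so its prefixes are prefixes of their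
    own images and can be desubstituted.\<close>
  have "prefix (pre (Suc i)) (ph (pre (Suc i)))"
    by (rule trib_prefix_linear) (simp_all only: trib_prefix_pre trib_prefix_ph length_ph)
  then have "prefix (pre i @ [La]) (ph (pre (Suc i)))"
    using assms by (simp only: pre_Suc)
  then obtain v where "prefix v (pre (Suc i))" "pre i = ph v"
    using prefix_ph_La by blast
  then have "pre i = ph (pre (length v))"
    using prefix_pre_eq by metis
  then have "i = posA (length v)"
    unfolding posA_def by (metis length_pre)
  then show ?thesis ..
qed

lemma letter_Lb_imp:
  assumes "letter_at i = Lb"
  shows "\<exists>k. i = posB k"
proof -
  let ?p = "pre (Suc i)"
  have "prefix ?p (ph ?p)"
    by (rule trib_prefix_linear) (simp_all only: trib_prefix_pre trib_prefix_ph length_ph)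
  then have 1: "prefix ?p (ph ?p)" "prefix (ph ?p) (ph (ph ?p))"
    by (simp_all add: prefix_ph)
  then have "prefix (pre i @ [Lb]) (ph ?p)"
    using assms by (simp only: pre_Suc)
  then obtain v where v: "prefix (v @ [La]) ?p" "pre i = ph v @ [La]"
    using prefix_ph_Lb by blast
  \<comment> \<open>Second desubstitution, at the \<open>La\<close> whose image contains the given
    \<open>Lb\<close>.\<close>
  with 1 have "prefix (v @ [La]) (ph ?p)"
    by (meson prefix_order.trans)
  then obtain u where "prefix u ?p" "v = ph u"
    using prefix_ph_La by blast
  then have "pre i = ph (ph (pre (length u))) @ [La]"
    using prefix_pre_eq v by metis
  then have "i = posB (length u)"
    unfolding posB_def by (metis length_pre length_append_singleton)
  then show ?thesis ..
qed

section \<open>The sequences read off from the Tribonacci word\<close>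

definition wt :: "nat \<Rightarrow> nat \<Rightarrow> nat \<Rightarrow> letter list \<Rightarrow> nat" where
  "wt a b c w = a * count_list w La + b * count_list w Lb + c * count_list w Lc"

lemma wt_simps [simp]:
  "wt a b c [] = 0"
  "wt a b c (x # w) = (case x of La \<Rightarrow> a | Lb \<Rightarrow> b | Lc \<Rightarrow> c) + wt a b c w"
  "wt a b c (v @ w) = wt a b c v + wt a b c w"
  by (simp_all add: wt_def algebra_simps split: letter.split)

text \<open>The incidence matrix of the substitution acting on weights. It turns (2,1,1) into
  (3,3,2), and in two steps (1,2,1) into (5,4,3), which links \<open>xs\<close> to \<open>ys\<close>
  and \<open>ds\<close> to \<open>ss\<close>.\<close>

lemma wt_ph: "wt a b c (ph w) = wt (a + b) (a + c) a w"
proof (induction w)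
  case (Cons x w)
  then show ?case by (cases x) auto
qed simp

lemma length_conv_wt: "length w = wt 1 1 1 w"
proof (induction w)
  case (Cons x w)
  then show ?case by (cases x) auto
qed simp

lemma length_pre_wt: "wt 1 1 1 (pre n) = n"
  by (metis length_conv_wt length_pre)

text \<open>
  Indices are shifted by one: \<open>xs m\<close>, \<open>ys m\<close>, \<open>ds m\<close>, \<open>ss m\<close> are \<open>X\<close>, \<open>Y\<close>, \<open>Y - X\<close>,
  \<open>Y + X\<close> at \<open>m + 1\<close>.
\<close>

definition xs :: "nat \<Rightarrow> nat" where "xs m = 1 + wt 2 1 1 (pre m)"
definition ys :: "nat \<Rightarrow> nat" where "ys m = 2 + wt 3 3 2 (pre m)"
definition ds :: "nat \<Rightarrow> nat" where "ds m = 1 + wt 1 2 1 (pre m)"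
definition ss :: "nat \<Rightarrow> nat" where "ss m = 3 + wt 5 4 3 (pre m)"

lemma ys_eq: "ys m = xs m + ds m"
  by (simp add: xs_def ys_def ds_def wt_def)

lemma ss_eq: "ss m = xs m + ys m"
  by (simp add: xs_def ys_def ss_def wt_def)

lemma ds_pos: "0 < ds m" and xs_pos: "0 < xs m"
  by (simp_all add: ds_def xs_def)

lemma xs_Suc: "xs (Suc m) = xs m + (if letter_at m = La then 2 else 1)"
  by (simp add: xs_def pre_Suc split: letter.split)

lemma ds_Suc: "ds (Suc m) = ds m + (if letter_at m = Lb then 2 else 1)"
  by (simp add: ds_def pre_Suc split: letter.split)

lemma strict_mono_xs: "strict_mono xs" and strict_mono_ds: "strict_mono ds"
  by (auto simp: strict_mono_Suc_iff xs_Suc ds_Suc)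

lemma strict_mono_ys: "strict_mono ys"
  using strict_mono_xs strict_mono_ds
  by (simp add: strict_mono_def ys_eq add_strict_mono)

lemma strict_mono_ss: "strict_mono ss"
  using strict_mono_xs strict_mono_ys
  by (simp add: strict_mono_def ss_eq add_strict_mono)

lemma ys_conv_xs: "ys k = xs (posA k) + 1"
  by (simp add: ys_def xs_def pre_posA wt_ph)

lemma ss_conv_ds: "ss k = ds (posB k) + 1"
  by (simp add: ss_def ds_def pre_posB wt_ph numeral_eq_Suc)

text \<open>Starting at 1 with steps 1 and 2, \<open>f\<close> misses exactly the positive integers
  that follow a value at which the step is 2, and \<open>g\<close> lists these.\<close>

lemma complementary:
  fixes f g pos :: "nat \<Rightarrow> nat"
  assumes "f 0 = 1" "\<And>i. f (Suc i) = f i + (if P i then 2 else 1)"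
    and "\<And>i. P i \<longleftrightarrow> (\<exists>k. i = pos k)" "\<And>k. g k = f (pos k) + 1"
  shows "0 < v \<Longrightarrow> v \<in> range f \<union> range g" and "f i \<noteq> g k"
proof -
  show "0 < v \<Longrightarrow> v \<in> range f \<union> range g"
  proof (induction v)
    case (Suc v)
    show ?case
    proof (cases "v = 0")
      case True
      with assms(1) show ?thesis by (metis One_nat_def UnI1 rangeI)
    next
      case False
      with Suc consider i where "v = f i" | k where "v = g k" by blast
      then show ?thesis
      proof cases
        case (1 i)
        show ?thesis
        proof (cases "P i")
          case True
          with assms(3) obtain k where "i = pos k" by blast
          with 1 assms(4)[of k] have "Suc v = g k" by simp
          then show ?thesis by blast
        next
          case False
          with 1 assms(2)[of i] have "Suc v = f (Suc i)" by simp
          then show ?thesis by blast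
        qed
      next
        case (2 k)
        with assms(2)[of "pos k"] assms(3,4) have "Suc v = f (Suc (pos k))" by auto
        then show ?thesis by blast
      qed
    qed
  qed simp
next
  have mono: "strict_mono f"
    by (auto simp: strict_mono_Suc_iff assms(2))
  show "f i \<noteq> g k"
  proof
    assume "f i = g k"
    then have "f (pos k) < f i" "f i < f (Suc (pos k))"
      using assms(2)[of "pos k"] assms(3,4) by auto
    then show False
      using strict_mono_less[OF mono] by (metis less_antisym less_asym)
  qed
qed

lemma La_iff: "letter_at i = La \<longleftrightarrow> (\<exists>k. i = posA k)"
  using letter_posA letter_La_imp by blast

lemma Lb_iff: "letter_at i = Lb \<longleftrightarrow> (\<exists>k. i = posB k)"
  using letter_posB letter_Lb_imp by blast

lemma xs_0: "xs 0 = 1" and ds_0: "ds 0 = 1"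
  by (simp_all add: xs_def ds_def)

lemmas xs_ys_cover = complementary(1)[OF xs_0 xs_Suc La_iff ys_conv_xs]
lemmas xs_neq_ys = complementary(2)[OF xs_0 xs_Suc La_iff ys_conv_xs]
lemmas ds_ss_cover = complementary(1)[OF ds_0 ds_Suc Lb_iff ss_conv_ds]
lemmas ds_neq_ss = complementary(2)[OF ds_0 ds_Suc Lb_iff ss_conv_ds]

section \<open>The greedy sequences\<close>

lemma image_pred: "f ` {1..<Suc m} = (\<lambda>k. f (Suc k)) ` {..<m}"
  by (simp add: lessThan_atLeast0 flip: image_Suc_atLeastLessThan image_image)

lemma good_shifted:
  assumes "\<forall>k<m. X (Suc k) = xs k \<and> Y (Suc k) = ys k"
  shows "good X Y (Suc m) x y \<longleftrightarrow>
    0 < x \<and> x < y \<and> (\<forall>k<m. x \<noteq> xs k \<and> x \<noteq> ys k \<and> y \<noteq> xs k \<and> y \<noteq> ys k \<and>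
      y - x \<noteq> ds k \<and> y - x \<noteq> ss k)"
proof (cases "x < y")
  case True
  then have "int y - int x = int (ys k) - int (xs k) \<longleftrightarrow> y - x = ds k"
    "int y - int x = int (ys k) + int (xs k) \<longleftrightarrow> y - x = ss k" for k
    by (auto simp: ys_eq ss_eq)
  then show ?thesis
    using True assms unfolding good_def image_pred by (simp add: image_iff) blast
qed (simp add: good_def)

lemma good_xs_ys:
  assumes "\<forall>k<m. X (Suc k) = xs k \<and> Y (Suc k) = ys k"
  shows "good X Y (Suc m) (xs m) (ys m)"
proof -
  have "xs k < xs m" "ys k < ys m" "ds k < ds m" if "k < m" for k
    using that strict_mono_xs strict_mono_ys strict_mono_ds by (auto simp: strict_mono_def)
  moreover have "ys m - xs m = ds m"
    by (simp add: ys_eq)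
  moreover have "xs m < ys m"
    using ds_pos by (simp add: ys_eq)
  ultimately show ?thesis
    unfolding good_shifted[OF assms] using xs_pos xs_neq_ys ds_neq_ss
    by (metis less_irrefl)
qed

text \<open>A smaller \<open>x\<close> would by \<open>xs_ys_cover\<close> be a value of
  \<open>xs\<close> or \<open>ys\<close>, by monotonicity an earlier one, hence excluded.\<close>

lemma good_imp_xs_le:
  assumes "\<forall>k<m. X (Suc k) = xs k \<and> Y (Suc k) = ys k"
    and "good X Y (Suc m) x y"
  shows "xs m \<le> x"
proof (rule ccontr)
  assume less: "\<not> xs m \<le> x"
  from assms(2) have x: "0 < x" "\<And>k. k < m \<Longrightarrow> x \<noteq> xs k \<and> x \<noteq> ys k"
    unfolding good_shifted[OF assms(1)] by blast+
  from xs_ys_cover[OF x(1)] consider k where "x = xs k" | k where "x = ys k"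
    by blast
  then show False
  proof cases
    case 1
    with less have "k < m"
      using strict_mono_less[OF strict_mono_xs] by (simp add: not_le)
    with 1 x(2) show False by blast
  next
    case 2
    with less have "ys k < ys m"
      by (simp add: ys_eq)
    then have "k < m"
      using strict_mono_less[OF strict_mono_ys] by simp
    with 2 x(2) show False by blast
  qed
qed

lemma good_imp_ys_le:
  assumes "\<forall>k<m. X (Suc k) = xs k \<and> Y (Suc k) = ys k"
    and "good X Y (Suc m) (xs m) y"
  shows "ys m \<le> y"
proof (rule ccontr)
  assume less: "\<not> ys m \<le> y"
  define d where "d = y - xs m"
  from assms(2) have d: "0 < d" "\<And>k. k < m \<Longrightarrow> d \<noteq> ds k \<and> d \<noteq> ss k"
    unfolding good_shifted[OF assms(1)] d_def by auto
  have dm: "d < ds m"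
    using less d(1) by (simp add: d_def ys_eq)
  from ds_ss_cover[OF d(1)] consider k where "d = ds k" | k where "d = ss k"
    by blast
  then show False
  proof cases
    case 1
    with dm have "k < m"
      using strict_mono_less[OF strict_mono_ds] by simp
    with 1 d(2) show False by blast
  next
    case 2
    with dm have "ss k < ss m"
      by (simp add: ss_eq ys_eq)
    then have "k < m"
      using strict_mono_less[OF strict_mono_ss] by simp
    with 2 d(2) show False by blast
  qed
qed

lemma seq_eq: "seqX (Suc m) = xs m \<and> seqY (Suc m) = ys m"
proof (induction m rule: less_induct)
  case (less m)
  then have IH: "\<forall>k<m. seqX (Suc k) = xs k \<and> seqY (Suc k) = ys k"
    by blast
  show ?case
  proof (cases "m = 0")
    case True
    then show ?thesis
      by (simp add: seqX.simps[of "Suc 0"] seqY.simps[of "Suc 0"] xs_def ys_def)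
  next
    case False
    have "(LEAST x. \<exists>y. good seqX seqY (Suc m) x y) = xs m"
      using good_xs_ys[OF IH] good_imp_xs_le[OF IH] by (intro Least_equality) auto
    then have X: "seqX (Suc m) = xs m"
      using False by (simp add: seqX.simps[of "Suc m"])
    have "(LEAST y. good seqX seqY (Suc m) (xs m) y) = ys m"
      using good_xs_ys[OF IH] good_imp_ys_le[OF IH] by (intro Least_equality) auto
    with X show ?thesis
      using False by (simp add: seqY.simps[of "Suc m"])
  qed
qed

section \<open>Balanced pairs\<close>

text \<open>The first word is read up to \<open>m\<close> while the second is read up to
  \<open>xs m - 1\<close>, so paired blocks may differ in length. The list is chosen so that
  \<open>ph\<close> maps each pair to a concatenation of listed pairs.\<close>

inductive balanced :: "letter list \<Rightarrow> letter list \<Rightarrow> bool" where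
  "balanced [] []"
| "balanced s u \<Longrightarrow> balanced ([La, Lb] @ s) ([La, Lb, La] @ u)"
| "balanced s u \<Longrightarrow> balanced ([Lc] @ s) ([Lb] @ u)"
| "balanced s u \<Longrightarrow> balanced ([La] @ s) ([La, Lc] @ u)"
| "balanced s u \<Longrightarrow> balanced ([La] @ s) ([Lc, La] @ u)"
| "balanced s u \<Longrightarrow> balanced ([La, Lb] @ s) ([La, La, Lb] @ u)"
| "balanced s u \<Longrightarrow> balanced ([La, Lc] @ s) ([Lb, La, Lc] @ u)"
| "balanced s u \<Longrightarrow> balanced ([Lb, La] @ s) ([La, Lb, La] @ u)"
| "balanced s u \<Longrightarrow> balanced ([La, Lc, La, Lb] @ s) ([La, Lb, La, Lc, La, Lb] @ u)"
| "balanced s u \<Longrightarrow> balanced ([La, Lb] @ s) ([Lb, La, La] @ u)"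

lemma balanced_ph: "balanced s u \<Longrightarrow> balanced (ph s) (ph u)"
  by (induction rule: balanced.induct) (simp_all, (blast intro: balanced.intros[simplified])+)

lemma balanced_trib: "balanced ((ph ^^ k) [La, Lb]) ((ph ^^ k) [La, Lb, La])"
proof (induction k)
  case 0
  show ?case using balanced.intros(2)[OF balanced.intros(1)] by simp
qed (simp add: balanced_ph)

text \<open>The equalities say that the error vanishes at the end of the pair. The inequalities
  encode \<open>ys (xs m - 1) \<le> ss m < ys (xs m)\<close>; the \<open>+ 1\<close> is the constant
  3 of \<open>ss\<close> minus the constant 2 of \<open>ys\<close>.\<close>

definition close :: "letter list \<Rightarrow> letter list \<Rightarrow> bool" where
  "close s u \<longleftrightarrow> length u = wt 2 1 1 s \<and> wt 3 3 2 u = wt 5 4 3 s \<and>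
    (\<forall>m<length s. let p = take m s; j = wt 2 1 1 p in
       j < length u \<and> wt 3 3 2 (take j u) \<le> wt 5 4 3 p + 1 \<and>
       wt 5 4 3 p + 1 < wt 3 3 2 (take (Suc j) u))"

text \<open>At a position in the second pair, the contributions of the first cancel by its
  equalities.\<close>

lemma close_append:
  assumes "close s u" "close s' u'"
  shows "close (s @ s') (u @ u')"
  unfolding close_def
proof (intro conjI allI impI)
  fix m assume m: "m < length (s @ s')"
  show "let p = take m (s @ s'); j = wt 2 1 1 p in
       j < length (u @ u') \<and> wt 3 3 2 (take j (u @ u')) \<le> wt 5 4 3 p + 1 \<and>
       wt 5 4 3 p + 1 < wt 3 3 2 (take (Suc j) (u @ u'))"
  proof (cases "m < length s")
    case True
    with assms(1) show ?thesis by (auto simp: close_def Let_def)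
  next
    case False
    then obtain i where "m = length s + i"
      by (metis le_add_diff_inverse not_less)
    with m assms show ?thesis by (auto simp: close_def Let_def)
  qed
qed (use assms in \<open>auto simp: close_def\<close>)

lemma balanced_imp_close: "balanced s u \<Longrightarrow> close s u"
proof (induction rule: balanced.induct)
  case 1
  show ?case by (simp add: close_def)
qed (erule close_append[rotated],
     simp add: close_def Let_def All_less_Suc)+

lemma ys_xs_le_ss: "ys (xs m - 1) \<le> ss m" and ss_less_ys_xs: "ss m < ys (xs m)"
proof -
  define s u where "s = (ph ^^ m) [La, Lb]" and "u = (ph ^^ m) [La, Lb, La]"
  have s: "s = trib (Suc m)"
    by (simp add: s_def trib_def funpow_swap1)
  \<comment> \<open>Appending \<open>Lc\<close> completes \<open>[La, Lb, La]\<close> to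
    \<open>trib 2\<close>, so \<open>u\<close> is a prefix of \<open>trib (m + 2)\<close>.\<close>
  have "prefix u ((ph ^^ m) ([La, Lb, La] @ [Lc]))"
    unfolding u_def ph_pow_append by simp
  also have "(ph ^^ m) ([La, Lb, La] @ [Lc]) = trib (Suc (Suc m))"
    by (simp add: trib_def funpow_swap1)
  finally have tu: "trib_prefix u"
    unfolding trib_prefix_def by blast
  have ts: "trib_prefix s"
    unfolding trib_prefix_def s by blast
  have m: "m < length s"
    using length_trib[of "Suc m"] s by simp
  then have p: "take m s = pre m"
    by (intro take_trib_prefix ts) simp
  define j where "j = wt 2 1 1 (pre m)"
  have "close s u"
    unfolding s_def u_def by (intro balanced_imp_close balanced_trib)
  then have j: "j < length u" and "wt 3 3 2 (take j u) \<le> wt 5 4 3 (pre m) + 1"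
    "wt 5 4 3 (pre m) + 1 < wt 3 3 2 (take (Suc j) u)"
    using m p by (auto simp: close_def Let_def j_def)
  moreover have "take j u = pre j" "take (Suc j) u = pre (Suc j)"
    using j by (auto intro!: take_trib_prefix tu)
  moreover have "xs m = Suc j"
    by (simp add: xs_def j_def)
  ultimately show "ys (xs m - 1) \<le> ss m" "ss m < ys (xs m)"
    by (simp_all add: ys_def ss_def)
qed

lemma xs_between_ys:
  assumes "ys j < xs i" "xs i < ys (Suc j)"
  shows "xs i = i + j + 2"
proof -
  \<comment> \<open>Pulled back along \<open>ph\<close>, the weights (1,0,0) counting
    \<open>La\<close> become (1,1,1), the length.\<close>
  have count: "count_list (pre (posA k)) La = k" for k
    using wt_ph[of 1 0 0 "pre k"] length_pre_wt[of k] by (simp add: pre_posA wt_def)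
  have mono: "count_list (pre k) La \<le> count_list (pre l) La" if "k \<le> l" for k l
    using pre_prefix[OF that] by (auto simp: prefix_def)
  from assms have "xs (posA j) < xs i" "xs i \<le> xs (posA (Suc j))"
    by (simp_all add: ys_conv_xs)
  then have "Suc (posA j) \<le> i" "i \<le> posA (Suc j)"
    using strict_mono_xs by (simp_all add: strict_mono_less strict_mono_less_eq)
  then have "count_list (pre (Suc (posA j))) La \<le> count_list (pre i) La"
    "count_list (pre i) La \<le> Suc j"
    using mono count by metis+
  \<comment> \<open>The lower bound includes the \<open>La\<close> at \<open>posA j\<close> itself.
    Then \<open>xs i\<close> is \<open>1 + i\<close> plus this count.\<close>
  then have "count_list (pre i) La = Suc j"
    by (simp add: pre_Suc letter_posA count)
  then show ?thesis
    using length_pre_wt[of i] by (simp add: xs_def wt_def)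
qed

theorem mainTheorem2:
  "(\<forall>n\<ge>1. seqX (seqY n) = seqX n + seqY n \<or> seqY (seqX n) = seqX n + seqY n) \<and>
   (\<forall>n\<ge>1. int (seqX n) + int (seqY n) - int (seqY (seqX n)) \<in> {0, 1, 2})"
proof -
  have "(seqX (seqY n) = seqX n + seqY n \<or> seqY (seqX n) = seqX n + seqY n) \<and>
    int (seqX n) + int (seqY n) - int (seqY (seqX n)) \<in> {0, 1, 2}" if "n \<ge> 1" for n
  proof -
    obtain m where n: "n = Suc m"
      using \<open>n \<ge> 1\<close> by (cases n) auto
    obtain j where j: "xs m = Suc j"
      using xs_pos gr0_implies_Suc by blast
    obtain y where y: "ys m = Suc y"
      by (simp add: ys_def)
    have seq: "seqX n = xs m" "seqY n = ys m" "seqY (xs m) = ys j" "seqX (ys m) = xs y"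
      by (simp_all add: n seq_eq j y)
    have lo: "ys j \<le> ss m" and hi: "ss m < ys (Suc j)"
      using ys_xs_le_ss[of m] ss_less_ys_xs[of m] by (simp_all add: j)
    \<comment> \<open>With \<open>lo\<close> and \<open>hi\<close> this leaves only 0, 1, 2 for
      \<open>ss m - ys j\<close>.\<close>
    have "ys (Suc j) \<le> ys j + 3"
      by (simp add: ys_def pre_Suc split: letter.split)
    moreover have "xs y = ss m" if "ys j \<noteq> ss m"
    proof -
      \<comment> \<open>Strictly between consecutive values of \<open>ys\<close>, the number
        \<open>ss m\<close> must be a value of \<open>xs\<close>.\<close>
      have "ss m \<notin> range ys"
        using that lo hi strict_mono_less[OF strict_mono_ys]
        by (metis imageE le_neq_implies_less less_antisym less_asym)
      then obtain i where i: "ss m = xs i"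
        using xs_ys_cover[of "ss m"] by (auto simp: ss_def)
      then have "xs i = i + j + 2"
        using that lo hi by (intro xs_between_ys) simp_all
      \<comment> \<open>Compare \<open>i + j + 2\<close> with
        \<open>ss m = xs m + ys m = (j + 1) + (y + 1)\<close>.\<close>
      then have "i = y"
        using i by (simp add: ss_eq j y)
      with i show ?thesis by simp
    qed
    ultimately show ?thesis
      using lo hi by (auto simp: seq ss_eq)
  qed
  then show ?thesis by blast
qed

end
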